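(* Let $\mathcal{C}$ be a category. The 2-category $\mathsf{Fib}_{\mathcal{C}}$ is 2-thin; that is, any two 2-cells of $\mathsf{Fib}_{\mathcal{C}}$ with the same source 1-cell and the same target 1-cell are equal.
   Context: Paths. A path in $\mathcal{C}$ is a finite sequence $\mathbf{f}=(B_n\xrightarrow{f_n}B_{n-1}\xrightarrow{f_{n-1}}\cdots\xrightarrow{f_1}B_0)$, $n\ge1$, of composable arrows, with source $B_n$ and target $B_0$; its value $[\mathbf{f}]:B_n\to B_0$ is the composite in $\mathcal{C}$. In addition, for each object $B$ there is an empty path $\emptyset_B$ with source and target $B$ and value $\mathrm{id}_B$. For paths $\mathbf{f}:A\to B$ and $\mathbf{g}:B\to C$, $\mathbf{f}\cdot\mathbf{g}:A\to C$ denotes their concatenation ($\mathbf{f}$ followed by $\mathbf{g}$). A single arrow is regarded as a path of length 1. Polygon types. A polygon type in $\mathcal{C}$ is a pair $(\mathbf{f},\mathbf{g})$ of paths (possibly empty) with the same source and the same target such that $[\mathbf{f}]=[\mathbf{g}]$; it is called degenerate if at least one of the paths is empty. The 2-polygraph $\Sigma^{*}_{\mathcal{C}}$. Its 0-cells are formal symbols $\mathcal{E}_A$, one for each object $A$ of $\mathcal{C}$; its generating 1-cells are formal symbols $f^{*}:\mathcal{E}_B\to\mathcal{E}_A$, one for each arrow $f:A\to B$ of $\mathcal{C}$. For a path $\mathbf{f}=(B_n\xrightarrow{f_n}B_{n-1}\xrightarrow{f_{n-1}}\cdots\xrightarrow{f_1}B_0)$ with $n\ge1$ write $\mathbf{f}^{*}:=f_n^{*}\cdots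 f_1^{*}:\mathcal{E}_{B_0}\to\mathcal{E}_{B_n}$ for the formal composite (in functional order, $f_1^{*}$ applied first), and let $\emptyset_B^{*}$ be the empty (identity) 1-cell at $\mathcal{E}_B$; thus $(\mathbf{f}\cdot\mathbf{g})^{*}=\mathbf{f}^{*}\mathbf{g}^{*}$. The generating 2-cells are $\chi_{(\mathbf{f},\mathbf{g})}:\mathbf{f}^{*}\Rightarrow\mathbf{g}^{*}$, one for each polygon type $(\mathbf{f},\mathbf{g})$ in $\mathcal{C}$, including degenerate ones. The 2-category $\mathsf{Fib}_{\mathcal{C}}$ is the quotient of the free strict 2-category on $\Sigma^{*}_{\mathcal{C}}$ by the congruence on 2-cells generated by the following relations, imposed for all polygon types including degenerate ones ($\circ$ is vertical composition, $\cdot$ between cells is horizontal composition/whiskering): (1) identity: $\chi_{(\mathbf{f},\mathbf{f})}=\mathrm{Id}_{\mathbf{f}^{*}}$; (2) vertical pasting: $\chi_{(\mathbf{g},\mathbf{h})}\circ\chi_{(\mathbf{f},\mathbf{g})}=\chi_{(\mathbf{f},\mathbf{h})}$; (3.1) left whiskering: $\chi_{(\mathbf{f},\mathbf{g})}\cdot a^{*}=\chi_{(\mathbf{f}\cdot a,\,\mathbf{g}\cdot a)}$ for every arrow $a$ of $\mathcal{C}$ whose source is the target of $\mathbf{f}$; (3.2) right whiskering: $b^{*}\cdot\chi_{(\mathbf{f},\mathbf{g})}=\chi_{(b\cdot\mathbf{f},\,b\cdot\mathbf{g})}$ for every arrow $b$ of $\mathcal{C}$ whose target is the source of $\mathbf{f}$.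 *)

theory Defs
  imports Main
begin

section \<open>Categories, paths and polygon types\<close>

(* Cmp C g f is the composite "g after f". *)
record ('o, 'a) category =
  Obj :: "'o set"
  Arr :: "'a set"
  Dom :: "'a \<Rightarrow> 'o"
  Cod :: "'a \<Rightarrow> 'o"
  Idn :: "'o \<Rightarrow> 'a"
  Cmp :: "'a \<Rightarrow> 'a \<Rightarrow> 'a"

locale category =
  fixes C :: "('o, 'a) category"
  assumes Dom_in: "f \<in> Arr C \<Longrightarrow> Dom C f \<in> Obj C"
    and Cod_in: "f \<in> Arr C \<Longrightarrow> Cod C f \<in> Obj C"
    and Idn_in: "A \<in> Obj C \<Longrightarrow> Idn C A \<in> Arr C"
    and Dom_Idn: "A \<in> Obj C \<Longrightarrow> Dom C (Idn C A) = A"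
    and Cod_Idn: "A \<in> Obj C \<Longrightarrow> Cod C (Idn C A) = A"
    and Cmp_in: "\<lbrakk>f \<in> Arr C; g \<in> Arr C; Cod C f = Dom C g\<rbrakk> \<Longrightarrow> Cmp C g f \<in> Arr C"
    and Dom_Cmp: "\<lbrakk>f \<in> Arr C; g \<in> Arr C; Cod C f = Dom C g\<rbrakk> \<Longrightarrow> Dom C (Cmp C g f) = Dom C f"
    and Cod_Cmp: "\<lbrakk>f \<in> Arr C; g \<in> Arr C; Cod C f = Dom C g\<rbrakk> \<Longrightarrow> Cod C (Cmp C g f) = Cod C g"
    and Cmp_Idn_left: "f \<in> Arr C \<Longrightarrow> Cmp C (Idn C (Cod C f)) f = f"
    and Cmp_Idn_right: "f \<in> Arr C \<Longrightarrow> Cmp C f (Idn C (Dom C f)) = f"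
    and Cmp_assoc: "\<lbrakk>f \<in> Arr C; g \<in> Arr C; h \<in> Arr C; Cod C f = Dom C g; Cod C g = Dom C h\<rbrakk>
          \<Longrightarrow> Cmp C h (Cmp C g f) = Cmp C (Cmp C h g) f"

(* Path A [f_n, ..., f_1] B lists the arrows in the order in which they are traversed;
   the end points are recorded so that there is one empty path for each object. *)
datatype ('o, 'a) path = Path (source: 'o) (arrows: "'a list") (target: 'o)

fun chain :: "('o, 'a) category \<Rightarrow> 'o \<Rightarrow> 'a list \<Rightarrow> 'o \<Rightarrow> bool" where
  "chain C A [] B \<longleftrightarrow> A \<in> Obj C \<and> A = B"
| "chain C A (f # fs) B \<longleftrightarrow> f \<in> Arr C \<and> Dom C f = A \<and> chain C (Cod C f) fs B"

definition paths :: "('o, 'a) category \<Rightarrow> ('o, 'a) path set" where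
  "paths C = {p. chain C (source p) (arrows p) (target p)}"

fun composite :: "('o, 'a) category \<Rightarrow> 'o \<Rightarrow> 'a list \<Rightarrow> 'a" where
  "composite C A [] = Idn C A"
| "composite C A [f] = f"
| "composite C A (f # g # fs) = Cmp C (composite C (Cod C f) (g # fs)) f"

definition val :: "('o, 'a) category \<Rightarrow> ('o, 'a) path \<Rightarrow> 'a" where
  "val C p = composite C (source p) (arrows p)"

definition concat_path :: "('o, 'a) path \<Rightarrow> ('o, 'a) path \<Rightarrow> ('o, 'a) path" where
  "concat_path p q = Path (source p) (arrows p @ arrows q) (target q)"

definition arrow_path :: "('o, 'a) category \<Rightarrow> 'a \<Rightarrow> ('o, 'a) path" where
  "arrow_path C f = Path (Dom C f) [f] (Cod C f)"

definition polygon_types :: "('o, 'a) category \<Rightarrow> (('o, 'a) path \<times> ('o, 'a) path) set" where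
  "polygon_types C = {(p, q). p \<in> paths C \<and> q \<in> paths C \<and>
     source p = source q \<and> target p = target q \<and> val C p = val C q}"


section \<open>Strict 2-categories\<close>

(* All compositions are in functional order.  For 2-cells a : u \<Rightarrow> u' between 1-cells X \<rightarrow> Y
   and b : v \<Rightarrow> v' between 1-cells Y \<rightarrow> Z, HCmp b a : v u \<Rightarrow> v' u'. *)
record ('x, 'f, 't) two_cat =
  Cell0 :: "'x set"
  Cell1 :: "'f set"
  Src1 :: "'f \<Rightarrow> 'x"
  Tgt1 :: "'f \<Rightarrow> 'x"
  Id1 :: "'x \<Rightarrow> 'f"
  Cmp1 :: "'f \<Rightarrow> 'f \<Rightarrow> 'f"
  Cell2 :: "'t set"
  Src2 :: "'t \<Rightarrow> 'f"
  Tgt2 :: "'t \<Rightarrow> 'f"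
  Id2 :: "'f \<Rightarrow> 't"
  VCmp :: "'t \<Rightarrow> 't \<Rightarrow> 't"
  HCmp :: "'t \<Rightarrow> 't \<Rightarrow> 't"

definition vcomposable :: "('x, 'f, 't) two_cat \<Rightarrow> 't \<Rightarrow> 't \<Rightarrow> bool" where
  "vcomposable X b a \<longleftrightarrow> a \<in> Cell2 X \<and> b \<in> Cell2 X \<and> Tgt2 X a = Src2 X b"

definition hcomposable :: "('x, 'f, 't) two_cat \<Rightarrow> 't \<Rightarrow> 't \<Rightarrow> bool" where
  "hcomposable X b a \<longleftrightarrow> a \<in> Cell2 X \<and> b \<in> Cell2 X \<and> Tgt1 X (Src2 X a) = Src1 X (Src2 X b)"

(* The data and typing conditions of a strict 2-category whose 1-cells already form a
   category; nothing is assumed about equality of 2-cells. *)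
locale pre_two_category =
  fixes X :: "('x, 'f, 't) two_cat"
  assumes Src1_in: "u \<in> Cell1 X \<Longrightarrow> Src1 X u \<in> Cell0 X"
    and Tgt1_in: "u \<in> Cell1 X \<Longrightarrow> Tgt1 X u \<in> Cell0 X"
    and Id1_in: "x \<in> Cell0 X \<Longrightarrow> Id1 X x \<in> Cell1 X \<and> Src1 X (Id1 X x) = x \<and> Tgt1 X (Id1 X x) = x"
    and Cmp1_in: "\<lbrakk>u \<in> Cell1 X; v \<in> Cell1 X; Tgt1 X u = Src1 X v\<rbrakk>
          \<Longrightarrow> Cmp1 X v u \<in> Cell1 X \<and> Src1 X (Cmp1 X v u) = Src1 X u \<and> Tgt1 X (Cmp1 X v u) = Tgt1 X v"
    and Cmp1_Id1_left: "u \<in> Cell1 X \<Longrightarrow> Cmp1 X (Id1 X (Tgt1 X u)) u = u"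
    and Cmp1_Id1_right: "u \<in> Cell1 X \<Longrightarrow> Cmp1 X u (Id1 X (Src1 X u)) = u"
    and Cmp1_assoc: "\<lbrakk>u \<in> Cell1 X; v \<in> Cell1 X; w \<in> Cell1 X; Tgt1 X u = Src1 X v; Tgt1 X v = Src1 X w\<rbrakk>
          \<Longrightarrow> Cmp1 X w (Cmp1 X v u) = Cmp1 X (Cmp1 X w v) u"
    and Src2_in: "a \<in> Cell2 X \<Longrightarrow> Src2 X a \<in> Cell1 X"
    and Tgt2_in: "a \<in> Cell2 X \<Longrightarrow> Tgt2 X a \<in> Cell1 X"
    and Src1_Tgt2: "a \<in> Cell2 X \<Longrightarrow> Src1 X (Tgt2 X a) = Src1 X (Src2 X a)"
    and Tgt1_Tgt2: "a \<in> Cell2 X \<Longrightarrow> Tgt1 X (Tgt2 X a) = Tgt1 X (Src2 X a)"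
    and Id2_in: "u \<in> Cell1 X \<Longrightarrow> Id2 X u \<in> Cell2 X \<and> Src2 X (Id2 X u) = u \<and> Tgt2 X (Id2 X u) = u"
    and VCmp_in: "vcomposable X b a
          \<Longrightarrow> VCmp X b a \<in> Cell2 X \<and> Src2 X (VCmp X b a) = Src2 X a \<and> Tgt2 X (VCmp X b a) = Tgt2 X b"
    and HCmp_in: "hcomposable X b a
          \<Longrightarrow> HCmp X b a \<in> Cell2 X \<and> Src2 X (HCmp X b a) = Cmp1 X (Src2 X b) (Src2 X a)
            \<and> Tgt2 X (HCmp X b a) = Cmp1 X (Tgt2 X b) (Tgt2 X a)"

(* The pairs of 2-cells that the axioms of a strict 2-category require to be equal. *)
inductive_set two_cat_axioms :: "('x, 'f, 't) two_cat \<Rightarrow> ('t \<times> 't) set"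
  for X :: "('x, 'f, 't) two_cat" where
  v_assoc: "\<lbrakk>vcomposable X b a; vcomposable X c b\<rbrakk>
      \<Longrightarrow> (VCmp X c (VCmp X b a), VCmp X (VCmp X c b) a) \<in> two_cat_axioms X"
| v_unit_left: "a \<in> Cell2 X \<Longrightarrow> (VCmp X (Id2 X (Tgt2 X a)) a, a) \<in> two_cat_axioms X"
| v_unit_right: "a \<in> Cell2 X \<Longrightarrow> (VCmp X a (Id2 X (Src2 X a)), a) \<in> two_cat_axioms X"
| h_assoc: "\<lbrakk>hcomposable X b a; hcomposable X c b\<rbrakk>
      \<Longrightarrow> (HCmp X c (HCmp X b a), HCmp X (HCmp X c b) a) \<in> two_cat_axioms X"
| h_unit_left: "a \<in> Cell2 X
      \<Longrightarrow> (HCmp X (Id2 X (Id1 X (Tgt1 X (Src2 X a)))) a, a) \<in> two_cat_axioms X"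
| h_unit_right: "a \<in> Cell2 X
      \<Longrightarrow> (HCmp X a (Id2 X (Id1 X (Src1 X (Src2 X a)))), a) \<in> two_cat_axioms X"
| h_identity: "\<lbrakk>u \<in> Cell1 X; v \<in> Cell1 X; Tgt1 X u = Src1 X v\<rbrakk>
      \<Longrightarrow> (HCmp X (Id2 X v) (Id2 X u), Id2 X (Cmp1 X v u)) \<in> two_cat_axioms X"
| interchange: "\<lbrakk>vcomposable X a' a; vcomposable X b' b; hcomposable X b a\<rbrakk>
      \<Longrightarrow> (VCmp X (HCmp X b' a') (HCmp X b a), HCmp X (VCmp X b' b) (VCmp X a' a))
          \<in> two_cat_axioms X"

locale strict_two_category = pre_two_category +
  assumes axioms_hold: "(s, t) \<in> two_cat_axioms X \<Longrightarrow> s = t"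

definition two_thin :: "('x, 'f, 't) two_cat \<Rightarrow> bool" where
  "two_thin X \<longleftrightarrow> (\<forall>a \<in> Cell2 X. \<forall>b \<in> Cell2 X.
     Src2 X a = Src2 X b \<longrightarrow> Tgt2 X a = Tgt2 X b \<longrightarrow> a = b)"


section \<open>Quotients by generated congruences on 2-cells\<close>

inductive_set generated_congruence ::
    "('x, 'f, 't) two_cat \<Rightarrow> ('t \<times> 't) set \<Rightarrow> ('t \<times> 't) set"
  for X :: "('x, 'f, 't) two_cat" and R :: "('t \<times> 't) set" where
  base: "(a, b) \<in> R \<Longrightarrow> (a, b) \<in> generated_congruence X R"
| refl: "a \<in> Cell2 X \<Longrightarrow> (a, a) \<in> generated_congruence X R"
| sym: "(a, b) \<in> generated_congruence X R \<Longrightarrow> (b, a) \<in> generated_congruence X R"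
| trans: "\<lbrakk>(a, b) \<in> generated_congruence X R; (b, c) \<in> generated_congruence X R\<rbrakk>
      \<Longrightarrow> (a, c) \<in> generated_congruence X R"
| vcmp: "\<lbrakk>(a, a') \<in> generated_congruence X R; (b, b') \<in> generated_congruence X R; vcomposable X b a\<rbrakk>
      \<Longrightarrow> (VCmp X b a, VCmp X b' a') \<in> generated_congruence X R"
| hcmp: "\<lbrakk>(a, a') \<in> generated_congruence X R; (b, b') \<in> generated_congruence X R; hcomposable X b a\<rbrakk>
      \<Longrightarrow> (HCmp X b a, HCmp X b' a') \<in> generated_congruence X R"

definition cls :: "('x, 'f, 't) two_cat \<Rightarrow> ('t \<times> 't) set \<Rightarrow> 't \<Rightarrow> 't set" where
  "cls X R a = generated_congruence X R `` {a}"

definition rep :: "'t set \<Rightarrow> 't" where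
  "rep A = (SOME a. a \<in> A)"

definition quotient_two_cat ::
    "('x, 'f, 't) two_cat \<Rightarrow> ('t \<times> 't) set \<Rightarrow> ('x, 'f, 't set) two_cat" where
  "quotient_two_cat X R = \<lparr>
     Cell0 = Cell0 X, Cell1 = Cell1 X, Src1 = Src1 X, Tgt1 = Tgt1 X, Id1 = Id1 X, Cmp1 = Cmp1 X,
     Cell2 = Cell2 X // generated_congruence X R,
     Src2 = (\<lambda>A. Src2 X (rep A)),
     Tgt2 = (\<lambda>A. Tgt2 X (rep A)),
     Id2 = (\<lambda>u. cls X R (Id2 X u)),
     VCmp = (\<lambda>B A. cls X R (VCmp X (rep B) (rep A))),
     HCmp = (\<lambda>B A. cls X R (HCmp X (rep B) (rep A)))\<rparr>"

definition parallel_cells :: "('x, 'f, 't) two_cat \<Rightarrow> ('t \<times> 't) set" where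
  "parallel_cells X = {(a, b). a \<in> Cell2 X \<and> b \<in> Cell2 X \<and>
     Src2 X a = Src2 X b \<and> Tgt2 X a = Tgt2 X b}"

context pre_two_category
begin

lemma congruence_parallel:
  assumes R: "R \<subseteq> parallel_cells X" and "(a, b) \<in> generated_congruence X R"
  shows "(a, b) \<in> parallel_cells X"
  using assms(2)
proof (induction)
  case (vcmp a a' b b')
  then have "vcomposable X b' a'" by (auto simp: vcomposable_def parallel_cells_def)
  with vcmp show ?case using VCmp_in[of b a] VCmp_in[of b' a'] by (auto simp: parallel_cells_def)
next
  case (hcmp a a' b b')
  then have "hcomposable X b' a'" by (auto simp: hcomposable_def parallel_cells_def)
  with hcmp show ?case using HCmp_in[of b a] HCmp_in[of b' a'] by (auto simp: parallel_cells_def)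
qed (use R in \<open>auto simp: parallel_cells_def\<close>)

lemma congruence_equiv:
  assumes R: "R \<subseteq> parallel_cells X"
  shows "equiv (Cell2 X) (generated_congruence X R)"
  by (rule equivI)
     (use congruence_parallel[OF R] in \<open>auto simp: parallel_cells_def
       intro!: refl_onI symI transI intro: generated_congruence.intros\<close>)

lemma cls_eq_iff:
  assumes R: "R \<subseteq> parallel_cells X" and "a \<in> Cell2 X" "b \<in> Cell2 X"
  shows "cls X R a = cls X R b \<longleftrightarrow> (a, b) \<in> generated_congruence X R"
  using eq_equiv_class_iff[OF congruence_equiv[OF R] assms(2,3)] by (simp add: cls_def)

lemma rep_cls:
  assumes R: "R \<subseteq> parallel_cells X" and a: "a \<in> Cell2 X"
  shows "(a, rep (cls X R a)) \<in> generated_congruence X R"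
proof -
  have "a \<in> cls X R a" using a by (auto simp: cls_def intro: generated_congruence.refl)
  then have "rep (cls X R a) \<in> cls X R a" unfolding rep_def by (rule someI)
  then show ?thesis by (simp add: cls_def)
qed

lemma quotient_boundary:
  assumes R: "R \<subseteq> parallel_cells X" and a: "a \<in> Cell2 X"
  shows "Src2 (quotient_two_cat X R) (cls X R a) = Src2 X a"
    and "Tgt2 (quotient_two_cat X R) (cls X R a) = Tgt2 X a"
  using congruence_parallel[OF R rep_cls[OF R a]]
  by (auto simp: quotient_two_cat_def parallel_cells_def)

lemma quotient_cell2:
  "A \<in> Cell2 (quotient_two_cat X R) \<longleftrightarrow> (\<exists>a \<in> Cell2 X. A = cls X R a)"
  by (auto simp: quotient_two_cat_def quotient_def cls_def)

lemma quotient_composable: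
  assumes R: "R \<subseteq> parallel_cells X" and a: "a \<in> Cell2 X" and b: "b \<in> Cell2 X"
  shows "vcomposable (quotient_two_cat X R) (cls X R b) (cls X R a) \<longleftrightarrow> vcomposable X b a"
    and "hcomposable (quotient_two_cat X R) (cls X R b) (cls X R a) \<longleftrightarrow> hcomposable X b a"
proof -
  have "cls X R a \<in> Cell2 (quotient_two_cat X R)" "cls X R b \<in> Cell2 (quotient_two_cat X R)"
    using a b quotient_cell2 by blast+
  moreover have "Src1 (quotient_two_cat X R) = Src1 X" "Tgt1 (quotient_two_cat X R) = Tgt1 X"
    by (simp_all add: quotient_two_cat_def)
  ultimately show "vcomposable (quotient_two_cat X R) (cls X R b) (cls X R a) \<longleftrightarrow> vcomposable X b a"
    and "hcomposable (quotient_two_cat X R) (cls X R b) (cls X R a) \<longleftrightarrow> hcomposable X b a"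
    using a b quotient_boundary[OF R] by (simp_all add: vcomposable_def hcomposable_def)
qed

lemma quotient_VCmp:
  assumes R: "R \<subseteq> parallel_cells X" and ab: "vcomposable X b a"
  shows "VCmp (quotient_two_cat X R) (cls X R b) (cls X R a) = cls X R (VCmp X b a)"
proof -
  have in2: "a \<in> Cell2 X" "b \<in> Cell2 X" using ab by (auto simp: vcomposable_def)
  have "(VCmp X b a, VCmp X (rep (cls X R b)) (rep (cls X R a))) \<in> generated_congruence X R"
    by (rule generated_congruence.vcmp[OF rep_cls[OF R in2(1)] rep_cls[OF R in2(2)] ab])
  then have "cls X R (VCmp X b a) = cls X R (VCmp X (rep (cls X R b)) (rep (cls X R a)))"
    unfolding cls_def by (rule equiv_class_eq[OF congruence_equiv[OF R]])
  then show ?thesis by (simp add: quotient_two_cat_def)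
qed

lemma quotient_HCmp:
  assumes R: "R \<subseteq> parallel_cells X" and ab: "hcomposable X b a"
  shows "HCmp (quotient_two_cat X R) (cls X R b) (cls X R a) = cls X R (HCmp X b a)"
proof -
  have in2: "a \<in> Cell2 X" "b \<in> Cell2 X" using ab by (auto simp: hcomposable_def)
  have "(HCmp X b a, HCmp X (rep (cls X R b)) (rep (cls X R a))) \<in> generated_congruence X R"
    by (rule generated_congruence.hcmp[OF rep_cls[OF R in2(1)] rep_cls[OF R in2(2)] ab])
  then have "cls X R (HCmp X b a) = cls X R (HCmp X (rep (cls X R b)) (rep (cls X R a)))"
    unfolding cls_def by (rule equiv_class_eq[OF congruence_equiv[OF R]])
  then show ?thesis by (simp add: quotient_two_cat_def)
qed

lemma quotient_simps [simp]:
  "Cell0 (quotient_two_cat X R) = Cell0 X"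
  "Cell1 (quotient_two_cat X R) = Cell1 X"
  "Src1 (quotient_two_cat X R) = Src1 X"
  "Tgt1 (quotient_two_cat X R) = Tgt1 X"
  "Id1 (quotient_two_cat X R) = Id1 X"
  "Cmp1 (quotient_two_cat X R) = Cmp1 X"
  "Id2 (quotient_two_cat X R) u = cls X R (Id2 X u)"
  by (simp_all add: quotient_two_cat_def)

lemma quotient_pre_two_category:
  assumes R: "R \<subseteq> parallel_cells X"
  shows "pre_two_category (quotient_two_cat X R)"
proof
  fix a b
  let ?Q = "quotient_two_cat X R"
  note B = quotient_boundary[OF R]
  show "Src2 ?Q a \<in> Cell1 ?Q" "Tgt2 ?Q a \<in> Cell1 ?Q"
    "Src1 ?Q (Tgt2 ?Q a) = Src1 ?Q (Src2 ?Q a)" "Tgt1 ?Q (Tgt2 ?Q a) = Tgt1 ?Q (Src2 ?Q a)"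
    if "a \<in> Cell2 ?Q"
    using that by (auto simp: quotient_cell2 B Src2_in Tgt2_in Src1_Tgt2 Tgt1_Tgt2)
  show "VCmp ?Q b a \<in> Cell2 ?Q \<and> Src2 ?Q (VCmp ?Q b a) = Src2 ?Q a \<and> Tgt2 ?Q (VCmp ?Q b a) = Tgt2 ?Q b"
    if ab: "vcomposable ?Q b a"
  proof -
    obtain s t where st: "s \<in> Cell2 X" "t \<in> Cell2 X" "a = cls X R s" "b = cls X R t"
      using ab by (auto simp: vcomposable_def quotient_cell2)
    then have c: "vcomposable X t s" using ab quotient_composable[OF R] by simp
    show ?thesis using VCmp_in[OF c] st B quotient_VCmp[OF R c] by (auto simp: quotient_cell2)
  qed
  show "HCmp ?Q b a \<in> Cell2 ?Q \<and> Src2 ?Q (HCmp ?Q b a) = Cmp1 ?Q (Src2 ?Q b) (Src2 ?Q a)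
      \<and> Tgt2 ?Q (HCmp ?Q b a) = Cmp1 ?Q (Tgt2 ?Q b) (Tgt2 ?Q a)"
    if ab: "hcomposable ?Q b a"
  proof -
    obtain s t where st: "s \<in> Cell2 X" "t \<in> Cell2 X" "a = cls X R s" "b = cls X R t"
      using ab by (auto simp: hcomposable_def quotient_cell2)
    then have c: "hcomposable X t s" using ab quotient_composable[OF R] by simp
    show ?thesis using HCmp_in[OF c] st B quotient_HCmp[OF R c] by (auto simp: quotient_cell2)
  qed
next
  fix u
  let ?Q = "quotient_two_cat X R"
  assume "u \<in> Cell1 ?Q"
  then show "Id2 ?Q u \<in> Cell2 ?Q \<and> Src2 ?Q (Id2 ?Q u) = u \<and> Tgt2 ?Q (Id2 ?Q u) = u"
    using Id2_in[of u] quotient_boundary[OF R] by (auto simp: quotient_cell2)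
qed (simp_all add: Src1_in Tgt1_in Id1_in Cmp1_in Cmp1_Id1_left Cmp1_Id1_right Cmp1_assoc)

lemma hcomposable_VCmp:
  assumes "vcomposable X a' a" "vcomposable X b' b" "hcomposable X b a"
  shows "hcomposable X b' a'" "hcomposable X (VCmp X b' b) (VCmp X a' a)"
    "vcomposable X (HCmp X b' a') (HCmp X b a)"
proof -
  show *: "hcomposable X b' a'"
    using assms Src1_Tgt2[of b] Tgt1_Tgt2[of a] by (simp add: hcomposable_def vcomposable_def)
  show "hcomposable X (VCmp X b' b) (VCmp X a' a)"
    using assms VCmp_in[of b' b] VCmp_in[of a' a] by (simp add: hcomposable_def)
  show "vcomposable X (HCmp X b' a') (HCmp X b a)"
    using assms HCmp_in[of b' a'] HCmp_in[of b a] * by (simp add: vcomposable_def)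
qed

lemma hcomposable_HCmp:
  assumes "hcomposable X b a" "hcomposable X c b"
  shows "hcomposable X c (HCmp X b a)" "hcomposable X (HCmp X c b) a"
  using assms HCmp_in[of b a] HCmp_in[of c b] Src2_in
    Cmp1_in[of "Src2 X a" "Src2 X b"] Cmp1_in[of "Src2 X b" "Src2 X c"]
  by (auto simp: hcomposable_def)

lemma vcomposable_VCmp:
  assumes "vcomposable X b a" "vcomposable X c b"
  shows "vcomposable X c (VCmp X b a)" "vcomposable X (VCmp X c b) a"
  using assms VCmp_in[of b a] VCmp_in[of c b] by (auto simp: vcomposable_def)

lemma composable_Id2:
  assumes "a \<in> Cell2 X"
  shows "vcomposable X (Id2 X (Tgt2 X a)) a" "vcomposable X a (Id2 X (Src2 X a))"
    "hcomposable X (Id2 X (Id1 X (Tgt1 X (Src2 X a)))) a"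
    "hcomposable X a (Id2 X (Id1 X (Src1 X (Src2 X a))))"
  using assms Id2_in Id1_in Src2_in Tgt2_in Src1_in Tgt1_in
  by (auto simp: vcomposable_def hcomposable_def)

lemma two_cat_axioms_parallel: "two_cat_axioms X \<subseteq> parallel_cells X"
proof (rule subrelI)
  fix s t
  assume "(s, t) \<in> two_cat_axioms X"
  then show "(s, t) \<in> parallel_cells X"
  proof cases
    case (v_assoc b a c)
    then show ?thesis
      using vcomposable_VCmp[of b a c] VCmp_in by (auto simp: parallel_cells_def)
  next
    case v_unit_left
    then show ?thesis using composable_Id2[of t] VCmp_in Id2_in[of "Tgt2 X t"] Tgt2_in[of t]
      by (auto simp: parallel_cells_def)
  next
    case v_unit_right
    then show ?thesis using composable_Id2[of t] VCmp_in Id2_in[of "Src2 X t"] Src2_in[of t]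
      by (auto simp: parallel_cells_def)
  next
    case (h_assoc b a c)
    have "a \<in> Cell2 X" "b \<in> Cell2 X" "c \<in> Cell2 X"
      using h_assoc by (auto simp: hcomposable_def)
    then show ?thesis
      using h_assoc hcomposable_HCmp[of b a c] HCmp_in Src1_Tgt2 Tgt1_Tgt2
        Cmp1_assoc[of "Src2 X a" "Src2 X b" "Src2 X c"] Cmp1_assoc[of "Tgt2 X a" "Tgt2 X b" "Tgt2 X c"]
        Src2_in Tgt2_in
      by (auto simp: parallel_cells_def hcomposable_def)
  next
    case h_unit_left
    then show ?thesis
      using composable_Id2[of t] HCmp_in Id1_in Id2_in Src2_in[of t] Tgt2_in[of t]
        Tgt1_in[of "Src2 X t"] Tgt1_Tgt2[of t] Cmp1_Id1_left[of "Src2 X t"] Cmp1_Id1_left[of "Tgt2 X t"]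
      by (auto simp: parallel_cells_def)
  next
    case h_unit_right
    then show ?thesis
      using composable_Id2[of t] HCmp_in Id1_in Id2_in Src2_in[of t] Tgt2_in[of t]
        Src1_in[of "Src2 X t"] Src1_Tgt2[of t] Cmp1_Id1_right[of "Src2 X t"] Cmp1_Id1_right[of "Tgt2 X t"]
      by (auto simp: parallel_cells_def)
  next
    case (h_identity u v)
    then have "hcomposable X (Id2 X v) (Id2 X u)" using Id2_in by (auto simp: hcomposable_def)
    then show ?thesis using h_identity HCmp_in Id2_in Cmp1_in[of u v]
      by (auto simp: parallel_cells_def)
  next
    case (interchange a' a b' b)
    note c = hcomposable_VCmp[OF interchange(3-5)]
    show ?thesis
      using interchange c VCmp_in[OF interchange(3)] VCmp_in[OF interchange(4)] VCmp_in[OF c(3)]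
        HCmp_in[OF c(1)] HCmp_in[OF c(2)] HCmp_in[OF interchange(5)]
      by (auto simp: parallel_cells_def)
  qed
qed

lemma quotient_axioms:
  assumes R: "R \<subseteq> parallel_cells X"
    and ax: "two_cat_axioms X \<subseteq> generated_congruence X R"
    and "(s, t) \<in> two_cat_axioms (quotient_two_cat X R)"
  shows "s = t"
proof -
  let ?Q = "quotient_two_cat X R"
  note V = quotient_VCmp[OF R] and H = quotient_HCmp[OF R] and B = quotient_boundary[OF R]
    and K = quotient_composable[OF R]
  have eq: "cls X R a = cls X R b" if "(a, b) \<in> two_cat_axioms X" for a b
    using that ax equiv_class_eq[OF congruence_equiv[OF R]] by (auto simp: cls_def)
  from assms(3) show ?thesis
  proof cases
    case (v_assoc B A C)
    then obtain a b c where abc: "a \<in> Cell2 X" "b \<in> Cell2 X" "c \<in> Cell2 X"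
      "A = cls X R a" "B = cls X R b" "C = cls X R c"
      by (auto simp: vcomposable_def quotient_cell2)
    with v_assoc K have c: "vcomposable X b a" "vcomposable X c b" by auto
    show ?thesis using v_assoc(1,2) abc V c vcomposable_VCmp[OF c] eq[OF two_cat_axioms.v_assoc[OF c]] by simp
  next
    case v_unit_left
    then obtain a where a: "a \<in> Cell2 X" "t = cls X R a" by (auto simp: quotient_cell2)
    show ?thesis using v_unit_left(1) a V composable_Id2[OF a(1)] B eq[OF two_cat_axioms.v_unit_left[OF a(1)]] by simp
  next
    case v_unit_right
    then obtain a where a: "a \<in> Cell2 X" "t = cls X R a" by (auto simp: quotient_cell2)
    show ?thesis using v_unit_right(1) a V composable_Id2[OF a(1)] B eq[OF two_cat_axioms.v_unit_right[OF a(1)]] by simp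
  next
    case (h_assoc B A C)
    then obtain a b c where abc: "a \<in> Cell2 X" "b \<in> Cell2 X" "c \<in> Cell2 X"
      "A = cls X R a" "B = cls X R b" "C = cls X R c"
      by (auto simp: hcomposable_def quotient_cell2)
    with h_assoc K have c: "hcomposable X b a" "hcomposable X c b" by auto
    show ?thesis using h_assoc(1,2) abc H c hcomposable_HCmp[OF c] eq[OF two_cat_axioms.h_assoc[OF c]] by simp
  next
    case h_unit_left
    then obtain a where a: "a \<in> Cell2 X" "t = cls X R a" by (auto simp: quotient_cell2)
    show ?thesis using h_unit_left(1) a H composable_Id2[OF a(1)] B eq[OF two_cat_axioms.h_unit_left[OF a(1)]] by simp
  next
    case h_unit_right
    then obtain a where a: "a \<in> Cell2 X" "t = cls X R a" by (auto simp: quotient_cell2)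
    show ?thesis using h_unit_right(1) a H composable_Id2[OF a(1)] B eq[OF two_cat_axioms.h_unit_right[OF a(1)]] by simp
  next
    case (h_identity u v)
    then have uv: "u \<in> Cell1 X" "v \<in> Cell1 X" "Tgt1 X u = Src1 X v" by simp_all
    have "hcomposable X (Id2 X v) (Id2 X u)" using uv Id2_in by (auto simp: hcomposable_def)
    then show ?thesis using h_identity(1,2) H eq[OF two_cat_axioms.h_identity[OF uv]] by simp
  next
    case (interchange A' A B' B)
    then obtain a b a' b' where abc: "a \<in> Cell2 X" "b \<in> Cell2 X" "a' \<in> Cell2 X" "b' \<in> Cell2 X"
      "A = cls X R a" "B = cls X R b" "A' = cls X R a'" "B' = cls X R b'"
      by (auto simp: vcomposable_def quotient_cell2)
    with interchange K have c: "vcomposable X a' a" "vcomposable X b' b" "hcomposable X b a" by auto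
    show ?thesis
      using interchange(1,2) abc V H c hcomposable_VCmp[OF c] eq[OF two_cat_axioms.interchange[OF c]] by simp
  qed
qed

lemma quotient_strict_two_category:
  assumes "R \<subseteq> parallel_cells X" "two_cat_axioms X \<subseteq> generated_congruence X R"
  shows "strict_two_category (quotient_two_cat X R)"
  using quotient_pre_two_category[OF assms(1)] quotient_axioms[OF assms]
  by (simp add: strict_two_category_def strict_two_category_axioms_def)

end


section \<open>The free strict 2-category on a 2-polygraph\<close>

(* A 1-cell of the free category on the 1-dimensional part of a polygraph.  The letters are
   in functional order: the last letter starts at the source. *)
datatype ('x, 'e) word = Word (wtgt: 'x) (letters: "'e list") (wsrc: 'x)

record ('x, 'e, 'g) polygraph =
  PCell0 :: "'x set"
  Gen1 :: "'e set"
  GSrc1 :: "'e \<Rightarrow> 'x"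
  GTgt1 :: "'e \<Rightarrow> 'x"
  Gen2 :: "'g set"
  GSrc2 :: "'g \<Rightarrow> ('x, 'e) word"
  GTgt2 :: "'g \<Rightarrow> ('x, 'e) word"

fun word_chain :: "('x, 'e, 'g) polygraph \<Rightarrow> 'x \<Rightarrow> 'e list \<Rightarrow> 'x \<Rightarrow> bool" where
  "word_chain P y [] x \<longleftrightarrow> x \<in> PCell0 P \<and> y = x"
| "word_chain P y (e # es) x \<longleftrightarrow> e \<in> Gen1 P \<and> GTgt1 P e = y \<and> word_chain P (GSrc1 P e) es x"

definition words :: "('x, 'e, 'g) polygraph \<Rightarrow> ('x, 'e) word set" where
  "words P = {u. word_chain P (wtgt u) (letters u) (wsrc u)}"

definition word_comp :: "('x, 'e) word \<Rightarrow> ('x, 'e) word \<Rightarrow> ('x, 'e) word" where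
  "word_comp v u = Word (wtgt v) (letters v @ letters u) (wsrc u)"

locale polygraph =
  fixes P :: "('x, 'e, 'g) polygraph"
  assumes GSrc1_in: "e \<in> Gen1 P \<Longrightarrow> GSrc1 P e \<in> PCell0 P"
    and GTgt1_in: "e \<in> Gen1 P \<Longrightarrow> GTgt1 P e \<in> PCell0 P"
    and GSrc2_in: "g \<in> Gen2 P \<Longrightarrow> GSrc2 P g \<in> words P"
    and GTgt2_in: "g \<in> Gen2 P \<Longrightarrow> GTgt2 P g \<in> words P"
    and wsrc_GTgt2: "g \<in> Gen2 P \<Longrightarrow> wsrc (GTgt2 P g) = wsrc (GSrc2 P g)"
    and wtgt_GTgt2: "g \<in> Gen2 P \<Longrightarrow> wtgt (GTgt2 P g) = wtgt (GSrc2 P g)"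

(* Formal 2-cell expressions; TV b a and TH b a are formal vertical and horizontal composites. *)
datatype ('x, 'e, 'g) two_term =
    TGen 'g
  | TId "('x, 'e) word"
  | TV "('x, 'e, 'g) two_term" "('x, 'e, 'g) two_term"
  | TH "('x, 'e, 'g) two_term" "('x, 'e, 'g) two_term"

primrec tsrc :: "('x, 'e, 'g) polygraph \<Rightarrow> ('x, 'e, 'g) two_term \<Rightarrow> ('x, 'e) word" where
  "tsrc P (TGen g) = GSrc2 P g"
| "tsrc P (TId u) = u"
| "tsrc P (TV b a) = tsrc P a"
| "tsrc P (TH b a) = word_comp (tsrc P b) (tsrc P a)"

primrec ttgt :: "('x, 'e, 'g) polygraph \<Rightarrow> ('x, 'e, 'g) two_term \<Rightarrow> ('x, 'e) word" where
  "ttgt P (TGen g) = GTgt2 P g"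
| "ttgt P (TId u) = u"
| "ttgt P (TV b a) = ttgt P b"
| "ttgt P (TH b a) = word_comp (ttgt P b) (ttgt P a)"

inductive_set terms :: "('x, 'e, 'g) polygraph \<Rightarrow> ('x, 'e, 'g) two_term set"
  for P :: "('x, 'e, 'g) polygraph" where
  "g \<in> Gen2 P \<Longrightarrow> TGen g \<in> terms P"
| "u \<in> words P \<Longrightarrow> TId u \<in> terms P"
| "\<lbrakk>a \<in> terms P; b \<in> terms P; ttgt P a = tsrc P b\<rbrakk> \<Longrightarrow> TV b a \<in> terms P"
| "\<lbrakk>a \<in> terms P; b \<in> terms P; wtgt (tsrc P a) = wsrc (tsrc P b)\<rbrakk> \<Longrightarrow> TH b a \<in> terms P"

definition term_two_cat ::
    "('x, 'e, 'g) polygraph \<Rightarrow> ('x, ('x, 'e) word, ('x, 'e, 'g) two_term) two_cat" where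
  "term_two_cat P = \<lparr>
     Cell0 = PCell0 P, Cell1 = words P, Src1 = wsrc, Tgt1 = wtgt,
     Id1 = (\<lambda>x. Word x [] x), Cmp1 = word_comp,
     Cell2 = terms P, Src2 = tsrc P, Tgt2 = ttgt P, Id2 = TId, VCmp = TV, HCmp = TH\<rparr>"

(* Well-typed 2-cell expressions modulo exactly the axioms of strict 2-categories. *)
definition free_two_cat ::
    "('x, 'e, 'g) polygraph \<Rightarrow> ('x, ('x, 'e) word, ('x, 'e, 'g) two_term set) two_cat" where
  "free_two_cat P = quotient_two_cat (term_two_cat P) (two_cat_axioms (term_two_cat P))"

definition gen2_cell :: "('x, 'e, 'g) polygraph \<Rightarrow> 'g \<Rightarrow> ('x, 'e, 'g) two_term set" where
  "gen2_cell P g = cls (term_two_cat P) (two_cat_axioms (term_two_cat P)) (TGen g)"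

lemma word_comp_ends [simp]: "wsrc (word_comp v u) = wsrc u" "wtgt (word_comp v u) = wtgt v"
  by (simp_all add: word_comp_def)

lemma word_chain_append:
  "\<lbrakk>word_chain P z es y; word_chain P y es' x\<rbrakk> \<Longrightarrow> word_chain P z (es @ es') x"
  by (induction es arbitrary: z) auto

context polygraph
begin

lemma word_chain_ends: "word_chain P y es x \<Longrightarrow> x \<in> PCell0 P \<and> y \<in> PCell0 P"
  by (induction es arbitrary: y) (auto simp: GTgt1_in)

lemma word_comp_in: "\<lbrakk>u \<in> words P; v \<in> words P; wtgt u = wsrc v\<rbrakk> \<Longrightarrow> word_comp v u \<in> words P"
  by (auto simp: words_def word_comp_def intro: word_chain_append)

lemma terms_boundary:
  "a \<in> terms P \<Longrightarrow> tsrc P a \<in> words P \<and> ttgt P a \<in> words P \<and>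
     wsrc (ttgt P a) = wsrc (tsrc P a) \<and> wtgt (ttgt P a) = wtgt (tsrc P a)"
proof (induction rule: terms.induct)
  case (4 a b)
  then show ?case using word_comp_in by simp
qed (simp_all add: GSrc2_in GTgt2_in wsrc_GTgt2 wtgt_GTgt2)

lemma term_pre_two_category: "pre_two_category (term_two_cat P)"
proof
  fix u
  assume "u \<in> Cell1 (term_two_cat P)"
  then have "wsrc u \<in> PCell0 P" "wtgt u \<in> PCell0 P"
    using word_chain_ends by (auto simp: term_two_cat_def words_def)
  then show "Src1 (term_two_cat P) u \<in> Cell0 (term_two_cat P)"
    "Tgt1 (term_two_cat P) u \<in> Cell0 (term_two_cat P)"
    by (simp_all add: term_two_cat_def)
qed (auto simp: term_two_cat_def terms_boundary word_comp_in vcomposable_def hcomposable_def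
      intro: terms.intros,
     auto simp: word_comp_def words_def)

lemma free_strict_two_category: "strict_two_category (free_two_cat P)"
  unfolding free_two_cat_def
  by (intro pre_two_category.quotient_strict_two_category term_pre_two_category
        pre_two_category.two_cat_axioms_parallel)
     (auto intro: generated_congruence.base)

lemma gen2_cell_in:
  assumes "g \<in> Gen2 P"
  shows "gen2_cell P g \<in> Cell2 (free_two_cat P)"
    "Src2 (free_two_cat P) (gen2_cell P g) = GSrc2 P g"
    "Tgt2 (free_two_cat P) (gen2_cell P g) = GTgt2 P g"
proof -
  interpret T: pre_two_category "term_two_cat P" by (rule term_pre_two_category)
  have g: "TGen g \<in> Cell2 (term_two_cat P)"
    using assms by (simp add: term_two_cat_def terms.intros)
  then show "gen2_cell P g \<in> Cell2 (free_two_cat P)"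
    unfolding gen2_cell_def free_two_cat_def T.quotient_cell2 by blast
  show "Src2 (free_two_cat P) (gen2_cell P g) = GSrc2 P g"
    "Tgt2 (free_two_cat P) (gen2_cell P g) = GTgt2 P g"
    using T.quotient_boundary[OF T.two_cat_axioms_parallel g]
    by (simp_all add: gen2_cell_def free_two_cat_def term_two_cat_def)
qed

end


section \<open>The 2-category Fib\<close>

datatype 'o fib_object = E 'o
datatype 'a fib_arrow = Star 'a
datatype ('o, 'a) fib_gen2 = Chi "('o, 'a) path" "('o, 'a) path"

(* For p : A \<rightarrow> B this is a 1-cell E B \<rightarrow> E A; since words are in functional order the list
   of arrows is not reversed. *)
definition star :: "('o, 'a) path \<Rightarrow> ('o fib_object, 'a fib_arrow) word" where
  "star p = Word (E (source p)) (map Star (arrows p)) (E (target p))"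

definition Sigma_star ::
    "('o, 'a) category \<Rightarrow> ('o fib_object, 'a fib_arrow, ('o, 'a) fib_gen2) polygraph" where
  "Sigma_star C = \<lparr>
     PCell0 = E ` Obj C,
     Gen1 = Star ` Arr C,
     GSrc1 = (\<lambda>e. case e of Star f \<Rightarrow> E (Cod C f)),
     GTgt1 = (\<lambda>e. case e of Star f \<Rightarrow> E (Dom C f)),
     Gen2 = {Chi p q | p q. (p, q) \<in> polygon_types C},
     GSrc2 = (\<lambda>g. case g of Chi p q \<Rightarrow> star p),
     GTgt2 = (\<lambda>g. case g of Chi p q \<Rightarrow> star q)\<rparr>"

type_synonym ('o, 'a) fib_free_cell =
  "('o fib_object, 'a fib_arrow, ('o, 'a) fib_gen2) two_term set"

definition free_fib :: "('o, 'a) category \<Rightarrow>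
    ('o fib_object, ('o fib_object, 'a fib_arrow) word, ('o, 'a) fib_free_cell) two_cat" where
  "free_fib C = free_two_cat (Sigma_star C)"

definition chi :: "('o, 'a) category \<Rightarrow> ('o, 'a) path \<Rightarrow> ('o, 'a) path \<Rightarrow> ('o, 'a) fib_free_cell" where
  "chi C p q = gen2_cell (Sigma_star C) (Chi p q)"

inductive_set fib_relations ::
    "('o, 'a) category \<Rightarrow> (('o, 'a) fib_free_cell \<times> ('o, 'a) fib_free_cell) set"
  for C :: "('o, 'a) category" where
  identity: "(p, p) \<in> polygon_types C
      \<Longrightarrow> (chi C p p, Id2 (free_fib C) (star p)) \<in> fib_relations C"
| vertical: "\<lbrakk>(p, q) \<in> polygon_types C; (q, r) \<in> polygon_types C\<rbrakk>
      \<Longrightarrow> (VCmp (free_fib C) (chi C q r) (chi C p q), chi C p r) \<in> fib_relations C"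
| left_whisker: "\<lbrakk>(p, q) \<in> polygon_types C; a \<in> Arr C; Dom C a = target p\<rbrakk>
      \<Longrightarrow> (HCmp (free_fib C) (chi C p q) (Id2 (free_fib C) (star (arrow_path C a))),
           chi C (concat_path p (arrow_path C a)) (concat_path q (arrow_path C a))) \<in> fib_relations C"
| right_whisker: "\<lbrakk>(p, q) \<in> polygon_types C; b \<in> Arr C; Cod C b = source p\<rbrakk>
      \<Longrightarrow> (HCmp (free_fib C) (Id2 (free_fib C) (star (arrow_path C b))) (chi C p q),
           chi C (concat_path (arrow_path C b) p) (concat_path (arrow_path C b) q)) \<in> fib_relations C"

definition Fib :: "('o, 'a) category \<Rightarrow>
    ('o fib_object, ('o fib_object, 'a fib_arrow) word, ('o, 'a) fib_free_cell set) two_cat" where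
  "Fib C = quotient_two_cat (free_fib C) (fib_relations C)"

lemma star_ends [simp]: "wsrc (star p) = E (target p)" "wtgt (star p) = E (source p)"
  by (simp_all add: star_def)

lemma chain_append: "\<lbrakk>chain C A fs B; chain C B gs D\<rbrakk> \<Longrightarrow> chain C A (fs @ gs) D"
  by (induction fs arbitrary: A) auto

lemma concat_path_in:
  "\<lbrakk>p \<in> paths C; q \<in> paths C; target p = source q\<rbrakk> \<Longrightarrow> concat_path p q \<in> paths C"
  by (auto simp: paths_def concat_path_def intro: chain_append)

lemma star_concat: "star (concat_path p q) = word_comp (star p) (star q)"
  by (simp add: star_def concat_path_def word_comp_def)

context category
begin

lemma arrow_path_in: "f \<in> Arr C \<Longrightarrow> arrow_path C f \<in> paths C"
  by (simp add: paths_def arrow_path_def Cod_in)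

lemma val_arrow_path: "val C (arrow_path C f) = f"
  by (simp add: val_def arrow_path_def)

lemma chain_ends: "chain C A fs B \<Longrightarrow> A \<in> Obj C \<and> B \<in> Obj C"
  by (induction fs arbitrary: A) (auto simp: Dom_in)

lemma composite_Cons:
  "chain C A (f # fs) B \<Longrightarrow> composite C A (f # fs) = Cmp C (composite C (Cod C f) fs) f"
  by (cases fs) (auto simp: Cmp_Idn_left)

lemma composite_in:
  "chain C A fs B \<Longrightarrow> composite C A fs \<in> Arr C \<and> Dom C (composite C A fs) = A \<and> Cod C (composite C A fs) = B"
proof (induction fs arbitrary: A)
  case Nil
  then show ?case by (auto simp: Idn_in Dom_Idn Cod_Idn)
next
  case (Cons f fs)
  then have IH: "composite C (Cod C f) fs \<in> Arr C" "Dom C (composite C (Cod C f) fs) = Cod C f"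
    "Cod C (composite C (Cod C f) fs) = B" and f: "f \<in> Arr C" "Dom C f = A" by auto
  show ?case
    using composite_Cons[OF Cons.prems] IH f Cmp_in Dom_Cmp Cod_Cmp by simp
qed

lemma composite_append:
  "\<lbrakk>chain C A fs B; chain C B gs D\<rbrakk>
    \<Longrightarrow> composite C A (fs @ gs) = Cmp C (composite C B gs) (composite C A fs)"
proof (induction fs arbitrary: A)
  case Nil
  then show ?case using composite_in[of B gs D] Cmp_Idn_right[of "composite C B gs"] by auto
next
  case (Cons f fs)
  have 1: "chain C A (f # (fs @ gs)) D" using chain_append[OF Cons.prems] by simp
  have 2: "chain C (Cod C f) fs B" "f \<in> Arr C" "Dom C f = A" using Cons.prems by auto
  show ?case
    using composite_Cons[OF 1] composite_Cons[OF Cons.prems(1)] Cons.IH[OF 2(1) Cons.prems(2)]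
      composite_in[OF 2(1)] composite_in[OF Cons.prems(2)] 2
      Cmp_assoc[of f "composite C (Cod C f) fs" "composite C B gs"] by simp
qed

lemma val_concat_path:
  "\<lbrakk>p \<in> paths C; q \<in> paths C; target p = source q\<rbrakk>
    \<Longrightarrow> val C (concat_path p q) = Cmp C (val C q) (val C p)"
  using composite_append by (auto simp: paths_def val_def concat_path_def)

lemma polygon_types_concat:
  assumes "(p, q) \<in> polygon_types C" "(p', q') \<in> polygon_types C" "target p = source p'"
  shows "(concat_path p p', concat_path q q') \<in> polygon_types C"
  using assms concat_path_in val_concat_path
  by (auto simp: polygon_types_def) (auto simp: concat_path_def)

lemma polygon_types_arrow: "f \<in> Arr C \<Longrightarrow> (arrow_path C f, arrow_path C f) \<in> polygon_types C"
  by (simp add: polygon_types_def arrow_path_in)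

lemma word_chain_star:
  "chain C A fs B \<Longrightarrow> word_chain (Sigma_star C) (E A) (map Star fs) (E B)"
  by (induction fs arbitrary: A) (auto simp: Sigma_star_def)

lemma star_in: "p \<in> paths C \<Longrightarrow> star p \<in> words (Sigma_star C)"
  by (auto simp: paths_def words_def star_def word_chain_star)

lemma Sigma_star_polygraph: "polygraph (Sigma_star C)"
proof
  fix g
  assume "g \<in> Gen2 (Sigma_star C)"
  then obtain p q where g: "g = Chi p q" "(p, q) \<in> polygon_types C"
    by (auto simp: Sigma_star_def)
  then have s: "GSrc2 (Sigma_star C) g = star p" "GTgt2 (Sigma_star C) g = star q"
    by (simp_all add: Sigma_star_def)
  show "GSrc2 (Sigma_star C) g \<in> words (Sigma_star C)" "GTgt2 (Sigma_star C) g \<in> words (Sigma_star C)"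
    "wsrc (GTgt2 (Sigma_star C) g) = wsrc (GSrc2 (Sigma_star C) g)"
    "wtgt (GTgt2 (Sigma_star C) g) = wtgt (GSrc2 (Sigma_star C) g)"
    unfolding s using g star_in by (auto simp: polygon_types_def)
qed (auto simp: Sigma_star_def Dom_in Cod_in)

lemma free_fib_strict_two_category: "strict_two_category (free_fib C)"
  unfolding free_fib_def by (rule polygraph.free_strict_two_category[OF Sigma_star_polygraph])

lemma chi_in:
  assumes "(p, q) \<in> polygon_types C"
  shows "chi C p q \<in> Cell2 (free_fib C)"
    "Src2 (free_fib C) (chi C p q) = star p"
    "Tgt2 (free_fib C) (chi C p q) = star q"
proof -
  have "Chi p q \<in> Gen2 (Sigma_star C)" using assms by (simp add: Sigma_star_def)
  from polygraph.gen2_cell_in[OF Sigma_star_polygraph this]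
  show "chi C p q \<in> Cell2 (free_fib C)"
    "Src2 (free_fib C) (chi C p q) = star p"
    "Tgt2 (free_fib C) (chi C p q) = star q"
    by (simp_all add: chi_def free_fib_def) (simp_all add: Sigma_star_def)
qed

lemma free_fib_1_cells:
  "Cell1 (free_fib C) = words (Sigma_star C)" "Cmp1 (free_fib C) = word_comp"
  "Src1 (free_fib C) = wsrc" "Tgt1 (free_fib C) = wtgt"
  by (simp_all add: free_fib_def free_two_cat_def quotient_two_cat_def term_two_cat_def)

lemma fib_relations_parallel: "fib_relations C \<subseteq> parallel_cells (free_fib C)"
proof (rule subrelI)
  interpret F: strict_two_category "free_fib C" by (rule free_fib_strict_two_category)
  have id: "Id2 (free_fib C) (star p) \<in> Cell2 (free_fib C)"
    "Src2 (free_fib C) (Id2 (free_fib C) (star p)) = star p"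
    "Tgt2 (free_fib C) (Id2 (free_fib C) (star p)) = star p" if "p \<in> paths C" for p
    using F.Id2_in[of "star p"] star_in[OF that] by (simp_all add: free_fib_1_cells)
  fix s t
  assume "(s, t) \<in> fib_relations C"
  then show "(s, t) \<in> parallel_cells (free_fib C)"
  proof cases
    case (identity p)
    then show ?thesis using chi_in[of p p] id[of p] by (simp add: parallel_cells_def polygon_types_def)
  next
    case (vertical p q r)
    then have "vcomposable (free_fib C) (chi C q r) (chi C p q)"
      by (simp add: vcomposable_def chi_in)
    moreover have "(p, r) \<in> polygon_types C" using vertical by (simp add: polygon_types_def)
    ultimately show ?thesis using vertical F.VCmp_in chi_in by (simp add: parallel_cells_def)
  next
    case (left_whisker p q a)
    note a = arrow_path_in[OF left_whisker(4)]
    have pq: "(concat_path p (arrow_path C a), concat_path q (arrow_path C a)) \<in> polygon_types C"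
      by (rule polygon_types_concat[OF left_whisker(3) polygon_types_arrow[OF left_whisker(4)]])
        (simp add: left_whisker(5) arrow_path_def)
    have "hcomposable (free_fib C) (chi C p q) (Id2 (free_fib C) (star (arrow_path C a)))"
      using left_whisker chi_in id[OF a]
      by (simp add: hcomposable_def free_fib_1_cells arrow_path_def)
    from F.HCmp_in[OF this] show ?thesis
      using left_whisker chi_in id[OF a] pq
      by (simp add: parallel_cells_def free_fib_1_cells star_concat)
  next
    case (right_whisker p q b)
    note b = arrow_path_in[OF right_whisker(4)]
    have pq: "(concat_path (arrow_path C b) p, concat_path (arrow_path C b) q) \<in> polygon_types C"
      by (rule polygon_types_concat[OF polygon_types_arrow[OF right_whisker(4)] right_whisker(3)])
        (simp add: right_whisker(5) arrow_path_def)
    have "hcomposable (free_fib C) (Id2 (free_fib C) (star (arrow_path C b))) (chi C p q)"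
      using right_whisker chi_in id[OF b]
      by (simp add: hcomposable_def free_fib_1_cells arrow_path_def)
    from F.HCmp_in[OF this] show ?thesis
      using right_whisker chi_in id[OF b] pq
      by (simp add: parallel_cells_def free_fib_1_cells star_concat)
  qed
qed

lemma Fib_strict_two_category: "strict_two_category (Fib C)"
proof -
  interpret F: strict_two_category "free_fib C" by (rule free_fib_strict_two_category)
  have "two_cat_axioms (free_fib C) \<subseteq> generated_congruence (free_fib C) (fib_relations C)"
  proof (rule subrelI)
    fix s t
    assume "(s, t) \<in> two_cat_axioms (free_fib C)"
    moreover from this have "s \<in> Cell2 (free_fib C)"
      using F.two_cat_axioms_parallel by (auto simp: parallel_cells_def)
    ultimately show "(s, t) \<in> generated_congruence (free_fib C) (fib_relations C)"
      using F.axioms_hold by (auto intro: generated_congruence.refl)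
  qed
  then show ?thesis
    unfolding Fib_def by (rule F.quotient_strict_two_category[OF fib_relations_parallel])
qed

end

end

(* Every 2-cell of Fib is the class of a single generator chi(p, q): identities by relation (1),
   vertical composites by (2), and a horizontal composite is, by interchange, a vertical composite
   of two whiskered generators, which are generators by iterating (3.1) and (3.2) along a path.
   Since p is determined by the word star p, a 2-cell is determined by its boundary. *)
theory Submission
  imports Defs
begin

section \<open>Two general tools: induction on free 2-cells and the whiskering decomposition\<close>

text \<open>A free 2-cell is the class of a well-typed term, and taking classes commutes with
  identities and both compositions. Term induction therefore descends to the quotient, with no check
  that \<open>Q\<close> respects the axioms.\<close>

lemma (in polygraph) free_cell_induct [consumes 1, case_names gen id vcmp hcmp]:
  fixes Q :: "('x, 'e, 'g) two_term set \<Rightarrow> bool"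
  defines "F \<equiv> free_two_cat P"
  assumes A: "A \<in> Cell2 F"
    and gen: "\<And>g. g \<in> Gen2 P \<Longrightarrow> Q (gen2_cell P g)"
    and id: "\<And>u. u \<in> words P \<Longrightarrow> Q (Id2 F u)"
    and vcmp: "\<And>a b. vcomposable F b a \<Longrightarrow> Q a \<Longrightarrow> Q b \<Longrightarrow> Q (VCmp F b a)"
    and hcmp: "\<And>a b. hcomposable F b a \<Longrightarrow> Q a \<Longrightarrow> Q b \<Longrightarrow> Q (HCmp F b a)"
  shows "Q A"
proof -
  let ?T = "term_two_cat P"
  let ?c = "cls ?T (two_cat_axioms ?T)"
  interpret T: pre_two_category ?T by (rule term_pre_two_category)
  note R = T.two_cat_axioms_parallel
  have F: "F = quotient_two_cat ?T (two_cat_axioms ?T)"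
    by (simp add: F_def free_two_cat_def)
  have "Q (?c t)" if "t \<in> terms P" for t
    using that
  proof (induction rule: terms.induct)
    case (1 g)
    then show ?case using gen by (simp add: gen2_cell_def)
  next
    case (2 u)
    then show ?case using id[of u] by (simp add: F) (simp add: term_two_cat_def)
  next
    case (3 a b)
    then have c: "vcomposable ?T b a" and ab: "a \<in> Cell2 ?T" "b \<in> Cell2 ?T"
      by (simp_all add: vcomposable_def term_two_cat_def)
    have "Q (VCmp F (?c b) (?c a))"
      using vcmp 3 c T.quotient_composable(1)[OF R ab] by (simp add: F)
    then show ?case using T.quotient_VCmp[OF R c] by (simp add: F) (simp add: term_two_cat_def)
  next
    case (4 a b)
    then have c: "hcomposable ?T b a" and ab: "a \<in> Cell2 ?T" "b \<in> Cell2 ?T"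
      by (simp_all add: hcomposable_def term_two_cat_def)
    have "Q (HCmp F (?c b) (?c a))"
      using hcmp 4 c T.quotient_composable(2)[OF R ab] by (simp add: F)
    then show ?case using T.quotient_HCmp[OF R c] by (simp add: F) (simp add: term_two_cat_def)
  qed
  moreover obtain t where "t \<in> Cell2 ?T" "A = ?c t"
    using A T.quotient_cell2 unfolding F by blast
  ultimately show ?thesis by (simp add: term_two_cat_def)
qed

text \<open>Interchange for \<open>b\<close> preceded by an identity and \<open>a\<close> followed
  by one; the vertical unit laws then remove both identities. This reduces horizontal composition to
  whiskering.\<close>

lemma (in strict_two_category) HCmp_eq_VCmp_whiskers:
  assumes "hcomposable X b a"
  shows "HCmp X b a = VCmp X (HCmp X b (Id2 X (Tgt2 X a))) (HCmp X (Id2 X (Src2 X b)) a)"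
proof -
  have ab: "a \<in> Cell2 X" "b \<in> Cell2 X" using assms by (auto simp: hcomposable_def)
  note c = composable_Id2(1)[OF ab(1)] composable_Id2(2)[OF ab(2)]
  have "hcomposable X (Id2 X (Src2 X b)) a"
    using assms ab Id2_in Src2_in by (simp add: hcomposable_def)
  then have "(VCmp X (HCmp X b (Id2 X (Tgt2 X a))) (HCmp X (Id2 X (Src2 X b)) a),
      HCmp X (VCmp X b (Id2 X (Src2 X b))) (VCmp X (Id2 X (Tgt2 X a)) a)) \<in> two_cat_axioms X"
    by (rule two_cat_axioms.interchange[OF c])
  then show ?thesis
    using axioms_hold two_cat_axioms.v_unit_left[OF ab(1)] two_cat_axioms.v_unit_right[OF ab(2)]
    by metis
qed

section \<open>Paths correspond to 1-cells\<close>

text \<open>Words record their end points just as paths do, so even empty paths stay distinct. Hence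
  the boundary of a generator determines its polygon type.\<close>

lemma star_inj: "star p = star q \<longleftrightarrow> p = q"
proof -
  have "map Star fs = map Star gs \<longleftrightarrow> fs = gs" for fs gs :: "'b list"
    by (rule inj_map_eq_map) (simp add: inj_def)
  then show ?thesis by (cases p; cases q) (simp add: star_def)
qed

text \<open>A word is decoded letter by letter: each generating 1-cell comes from an arrow with its
  ends swapped, and functional order of letters is traversal order of arrows. This makes every
  identity 2-cell one on a path.\<close>

lemma star_surj:
  assumes "u \<in> words (Sigma_star C)"
  shows "\<exists>p \<in> paths C. star p = u"
proof -
  have "\<exists>A fs B. y = E A \<and> es = map Star fs \<and> x = E B \<and> chain C A fs B"
    if "word_chain (Sigma_star C) y es x" for y es x
    using that
  proof (induction es arbitrary: y)
    case Nil
    then show ?case by (auto simp: Sigma_star_def)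
  next
    case (Cons e es)
    then obtain f where f: "e = Star f" "f \<in> Arr C" "y = E (Dom C f)"
      "word_chain (Sigma_star C) (E (Cod C f)) es x"
      by (auto simp: Sigma_star_def)
    from Cons.IH[OF f(4)] obtain fs B where "es = map Star fs" "x = E B" "chain C (Cod C f) fs B"
      by auto
    then have "e # es = map Star (f # fs)" "chain C (Dom C f) (f # fs) B" using f by simp_all
    then show ?case using f(3) \<open>x = E B\<close> by metis
  qed
  then obtain A fs B where "wtgt u = E A" "letters u = map Star fs" "wsrc u = E B" "chain C A fs B"
    using assms unfolding words_def by blast
  then have "Path A fs B \<in> paths C" "star (Path A fs B) = u"
    by (simp_all add: paths_def star_def word.expand)
  then show ?thesis by blast
qed

section \<open>Generators in the quotient and the defining relations as equations\<close>

definition fib_chi :: "('o, 'a) category \<Rightarrow> ('o, 'a) path \<Rightarrow> ('o, 'a) path \<Rightarrow> ('o, 'a) fib_free_cell set" where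
  "fib_chi C p q = cls (free_fib C) (fib_relations C) (chi C p q)"

context category
begin

interpretation F: strict_two_category "free_fib C"
  by (rule free_fib_strict_two_category)

interpretation Q: strict_two_category "Fib C"
  by (rule Fib_strict_two_category)

lemma Fib_1_cells:
  "Cell1 (Fib C) = words (Sigma_star C)" "Cmp1 (Fib C) = word_comp"
  "Src1 (Fib C) = wsrc" "Tgt1 (Fib C) = wtgt" "Id1 (Fib C) x = Word x [] x"
  by (simp_all add: Fib_def free_fib_1_cells)
    (simp add: quotient_two_cat_def free_fib_def free_two_cat_def term_two_cat_def)

text \<open>The passage from relations to equations: each of the four kinds of relation enters the
  proof through this lemma.\<close>

lemma fib_relation_cls:
  "(s, t) \<in> fib_relations C \<Longrightarrow>
    cls (free_fib C) (fib_relations C) s = cls (free_fib C) (fib_relations C) t"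
  unfolding cls_def
  by (rule equiv_class_eq[OF F.congruence_equiv[OF fib_relations_parallel]])
    (rule generated_congruence.base)

lemma fib_chi_in:
  assumes "(p, q) \<in> polygon_types C"
  shows "fib_chi C p q \<in> Cell2 (Fib C)" "Src2 (Fib C) (fib_chi C p q) = star p"
    "Tgt2 (Fib C) (fib_chi C p q) = star q"
  using chi_in[OF assms] F.quotient_boundary[OF fib_relations_parallel] F.quotient_cell2
  unfolding Fib_def fib_chi_def by auto

lemma Id2_star_in:
  assumes "p \<in> paths C"
  shows "Id2 (Fib C) (star p) \<in> Cell2 (Fib C)" "Src2 (Fib C) (Id2 (Fib C) (star p)) = star p"
    "Tgt2 (Fib C) (Id2 (Fib C) (star p)) = star p"
  using Q.Id2_in[of "star p"] star_in[OF assms] by (simp_all add: Fib_1_cells)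

lemma fib_chi_refl: "p \<in> paths C \<Longrightarrow> fib_chi C p p = Id2 (Fib C) (star p)"
  using fib_relation_cls[OF fib_relations.identity[of p C]]
  by (simp add: fib_chi_def Fib_def polygon_types_def)

lemma fib_chi_VCmp:
  assumes "(p, q) \<in> polygon_types C" "(q, r) \<in> polygon_types C"
  shows "VCmp (Fib C) (fib_chi C q r) (fib_chi C p q) = fib_chi C p r"
proof -
  have "vcomposable (free_fib C) (chi C q r) (chi C p q)"
    using assms chi_in by (simp add: vcomposable_def)
  then show ?thesis
    using F.quotient_VCmp[OF fib_relations_parallel] fib_relation_cls[OF fib_relations.vertical[OF assms]]
    by (simp add: fib_chi_def Fib_def)
qed

lemma free_Id2_arrow_in:
  assumes "a \<in> Arr C"
  shows "Id2 (free_fib C) (star (arrow_path C a)) \<in> Cell2 (free_fib C)"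
    "Src2 (free_fib C) (Id2 (free_fib C) (star (arrow_path C a))) = star (arrow_path C a)"
  using F.Id2_in star_in[OF arrow_path_in[OF assms]] by (simp_all add: free_fib_1_cells)

text \<open>The relation \<open>left_whisker\<close>, read in the quotient. The arrow is traversed
  after \<open>p\<close>; since \<open>star\<close> reverses direction but keeps the order of
  letters, its 1-cell is the right-hand factor.\<close>

lemma fib_chi_HCmp_arrow:
  assumes pq: "(p, q) \<in> polygon_types C" and a: "a \<in> Arr C" "Dom C a = target p"
  shows "HCmp (Fib C) (fib_chi C p q) (Id2 (Fib C) (star (arrow_path C a))) =
    fib_chi C (concat_path p (arrow_path C a)) (concat_path q (arrow_path C a))"
proof -
  have "hcomposable (free_fib C) (chi C p q) (Id2 (free_fib C) (star (arrow_path C a)))"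
    using chi_in[OF pq] free_Id2_arrow_in[OF a(1)] a
    by (simp add: hcomposable_def free_fib_1_cells) (simp add: arrow_path_def)
  then show ?thesis
    using F.quotient_HCmp[OF fib_relations_parallel]
      fib_relation_cls[OF fib_relations.left_whisker[OF assms]]
    by (simp add: fib_chi_def Fib_def)
qed

lemma arrow_HCmp_fib_chi:
  assumes pq: "(p, q) \<in> polygon_types C" and b: "b \<in> Arr C" "Cod C b = source p"
  shows "HCmp (Fib C) (Id2 (Fib C) (star (arrow_path C b))) (fib_chi C p q) =
    fib_chi C (concat_path (arrow_path C b) p) (concat_path (arrow_path C b) q)"
proof -
  have "hcomposable (free_fib C) (Id2 (free_fib C) (star (arrow_path C b))) (chi C p q)"
    using chi_in[OF pq] free_Id2_arrow_in[OF b(1)] b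
    by (simp add: hcomposable_def free_fib_1_cells) (simp add: arrow_path_def)
  then show ?thesis
    using F.quotient_HCmp[OF fib_relations_parallel]
      fib_relation_cls[OF fib_relations.right_whisker[OF assms]]
    by (simp add: fib_chi_def Fib_def)
qed

section \<open>From whiskering by arrows to whiskering by paths\<close>

text \<open>Arrows are added at the source end, matching the recursion of \<open>chain\<close>; this
  one scheme serves whiskering on either side.\<close>

lemma path_induct [consumes 1, case_names empty cons]:
  assumes "p \<in> paths C"
    and "\<And>A. A \<in> Obj C \<Longrightarrow> P (Path A [] A)"
    and "\<And>a p. a \<in> Arr C \<Longrightarrow> p \<in> paths C \<Longrightarrow> Cod C a = source p \<Longrightarrow> P p \<Longrightarrow>
      P (concat_path (arrow_path C a) p)"
  shows "P p"
proof -
  have "P (Path A fs B)" if "chain C A fs B" for A fs B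
    using that
  proof (induction fs arbitrary: A)
    case Nil
    then show ?case using assms(2) by auto
  next
    case (Cons f fs)
    then show ?case
      using assms(3)[of f "Path (Cod C f) fs B"]
      by (auto simp: paths_def concat_path_def arrow_path_def)
  qed
  then show ?thesis using assms(1) by (cases p) (simp add: paths_def)
qed

lemma concat_path_assoc: "concat_path (concat_path p q) r = concat_path p (concat_path q r)"
  by (simp add: concat_path_def)

text \<open>The axiom \<open>h_identity\<close> splits the identity on a path, so that associativity
  can peel off one arrow.\<close>

lemma Id2_star_arrow_concat:
  assumes "a \<in> Arr C" "r \<in> paths C" "Cod C a = source r"
  shows "Id2 (Fib C) (star (concat_path (arrow_path C a) r)) =
    HCmp (Fib C) (Id2 (Fib C) (star (arrow_path C a))) (Id2 (Fib C) (star r))"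
    and "hcomposable (Fib C) (Id2 (Fib C) (star (arrow_path C a))) (Id2 (Fib C) (star r))"
proof -
  have s: "wtgt (star r) = wsrc (star (arrow_path C a))"
    using assms by (simp add: arrow_path_def)
  then show "hcomposable (Fib C) (Id2 (Fib C) (star (arrow_path C a))) (Id2 (Fib C) (star r))"
    using Id2_star_in[OF assms(2)] Id2_star_in[OF arrow_path_in[OF assms(1)]]
    by (simp add: hcomposable_def Fib_1_cells)
  show "Id2 (Fib C) (star (concat_path (arrow_path C a) r)) =
      HCmp (Fib C) (Id2 (Fib C) (star (arrow_path C a))) (Id2 (Fib C) (star r))"
    using Q.axioms_hold[OF two_cat_axioms.h_identity[of "star r" "Fib C" "star (arrow_path C a)"]] s
      star_in[OF assms(2)] star_in[OF arrow_path_in[OF assms(1)]]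
    by (simp add: Fib_1_cells star_concat)
qed

text \<open>Associativity lets \<open>a\<close> act first, which replaces \<open>p\<close> and
  \<open>q\<close> by their extensions along \<open>a\<close>. The induction hypothesis is needed
  for these new paths, hence the generalization over \<open>p\<close> and \<open>q\<close>.\<close>

lemma fib_chi_HCmp_path:
  assumes "r \<in> paths C" "(p, q) \<in> polygon_types C" "source r = target p"
  shows "HCmp (Fib C) (fib_chi C p q) (Id2 (Fib C) (star r)) =
    fib_chi C (concat_path p r) (concat_path q r)"
  using assms
proof (induction r arbitrary: p q rule: path_induct)
  case (empty A)
  \<comment> \<open>An empty path gives an identity 1-cell, so the right unit law applies.\<close>
  have "star (Path A [] A) = Id1 (Fib C) (Src1 (Fib C) (Src2 (Fib C) (fib_chi C p q)))"
    using empty fib_chi_in by (simp add: Fib_1_cells) (simp add: star_def)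
  moreover have "concat_path p (Path A [] A) = p" "concat_path q (Path A [] A) = q"
    using empty by (auto simp: concat_path_def polygon_types_def path.expand)
  ultimately show ?case
    using Q.axioms_hold[OF two_cat_axioms.h_unit_right] fib_chi_in(1)[OF empty(2)] by simp
next
  case (cons a r)
  let ?I = "\<lambda>p. Id2 (Fib C) (star p)" and ?a = "arrow_path C a"
  have a: "Dom C a = target p" using cons by (simp add: concat_path_def arrow_path_def)
  have pq: "(concat_path p ?a, concat_path q ?a) \<in> polygon_types C"
    using polygon_types_concat[OF cons.prems(1) polygon_types_arrow[OF cons(1)]] a
    by (simp add: arrow_path_def)
  have "hcomposable (Fib C) (fib_chi C p q) (?I ?a)"
    using fib_chi_in[OF cons.prems(1)] Id2_star_in[OF arrow_path_in[OF cons(1)]] a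
    by (simp add: hcomposable_def Fib_1_cells) (simp add: arrow_path_def)
  then have "HCmp (Fib C) (fib_chi C p q) (?I (concat_path ?a r)) =
      HCmp (Fib C) (HCmp (Fib C) (fib_chi C p q) (?I ?a)) (?I r)"
    using Q.axioms_hold[OF two_cat_axioms.h_assoc] Id2_star_arrow_concat[OF cons(1-3)] by simp
  also have "\<dots> = HCmp (Fib C) (fib_chi C (concat_path p ?a) (concat_path q ?a)) (?I r)"
    using fib_chi_HCmp_arrow[OF cons.prems(1) cons(1) a] by simp
  also have "\<dots> = fib_chi C (concat_path (concat_path p ?a) r) (concat_path (concat_path q ?a) r)"
    using cons.IH[OF pq] cons(3) by (simp add: concat_path_def arrow_path_def)
  finally show ?case by (simp add: concat_path_assoc)
qed

text \<open>Here the added arrow is outermost: \<open>r\<close> acts first by the induction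
  hypothesis for the same \<open>p\<close> and \<open>q\<close>, then \<open>a\<close> acts on the
  resulting generator.\<close>

lemma path_HCmp_fib_chi:
  assumes "r \<in> paths C" "(p, q) \<in> polygon_types C" "target r = source p"
  shows "HCmp (Fib C) (Id2 (Fib C) (star r)) (fib_chi C p q) =
    fib_chi C (concat_path r p) (concat_path r q)"
  using assms
proof (induction r rule: path_induct)
  case (empty A)
  have "star (Path A [] A) = Id1 (Fib C) (Tgt1 (Fib C) (Src2 (Fib C) (fib_chi C p q)))"
    using empty fib_chi_in by (simp add: Fib_1_cells) (simp add: star_def)
  moreover have "concat_path (Path A [] A) p = p" "concat_path (Path A [] A) q = q"
    using empty by (auto simp: concat_path_def polygon_types_def path.expand)
  ultimately show ?case
    using Q.axioms_hold[OF two_cat_axioms.h_unit_left] fib_chi_in(1)[OF empty(2)] by simp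
next
  case (cons a r)
  let ?I = "\<lambda>p. Id2 (Fib C) (star p)" and ?a = "arrow_path C a"
  have r: "target r = source p" using cons by (simp add: concat_path_def)
  have rr: "(r, r) \<in> polygon_types C" using cons by (simp add: polygon_types_def)
  have pq: "(concat_path r p, concat_path r q) \<in> polygon_types C"
    by (rule polygon_types_concat[OF rr cons.prems(1) r])
  have "hcomposable (Fib C) (?I r) (fib_chi C p q)"
    using fib_chi_in[OF cons.prems(1)] Id2_star_in[OF cons(2)] r
    by (simp add: hcomposable_def Fib_1_cells)
  then have "HCmp (Fib C) (?I (concat_path ?a r)) (fib_chi C p q) =
      HCmp (Fib C) (?I ?a) (HCmp (Fib C) (?I r) (fib_chi C p q))"
    using Q.axioms_hold[OF two_cat_axioms.h_assoc] Id2_star_arrow_concat[OF cons(1-3)] by simp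
  also have "\<dots> = HCmp (Fib C) (?I ?a) (fib_chi C (concat_path r p) (concat_path r q))"
    using cons.IH[OF cons.prems(1) r] by simp
  also have "\<dots> = fib_chi C (concat_path ?a (concat_path r p)) (concat_path ?a (concat_path r q))"
    using arrow_HCmp_fib_chi[OF pq cons(1)] cons(3) by (simp add: concat_path_def)
  finally show ?case by (simp add: concat_path_assoc)
qed

text \<open>The whiskering decomposition passes through the intermediate path
  \<open>concat_path p q'\<close>: first \<open>p'\<close> is changed to \<open>q'\<close> with
  \<open>p\<close> fixed, then \<open>p\<close> to \<open>q\<close> with \<open>q'\<close> fixed.
  Vertical pasting joins the two generators.\<close>

lemma fib_chi_HCmp:
  assumes pq: "(p, q) \<in> polygon_types C" and pq': "(p', q') \<in> polygon_types C"
    and t: "target p = source p'"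
  shows "HCmp (Fib C) (fib_chi C p q) (fib_chi C p' q') =
    fib_chi C (concat_path p p') (concat_path q q')"
proof -
  have paths: "p \<in> paths C" "q' \<in> paths C" "source q' = target p"
    using assms by (simp_all add: polygon_types_def)
  then have refl: "(p, p) \<in> polygon_types C" "(q', q') \<in> polygon_types C"
    by (simp_all add: polygon_types_def)
  have "hcomposable (Fib C) (fib_chi C p q) (fib_chi C p' q')"
    using fib_chi_in[OF pq] fib_chi_in[OF pq'] t by (simp add: hcomposable_def Fib_1_cells)
  then show ?thesis
    using Q.HCmp_eq_VCmp_whiskers fib_chi_in[OF pq] fib_chi_in[OF pq']
      fib_chi_HCmp_path[OF paths(2) pq paths(3)] path_HCmp_fib_chi[OF paths(1) pq' t]
      fib_chi_VCmp[OF polygon_types_concat[OF refl(1) pq' t] polygon_types_concat[OF pq refl(2)]]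
      paths(3)
    by simp
qed

section \<open>Every 2-cell is a generator\<close>

text \<open>The induction runs in the free 2-category, where an induction principle is available;
  the preceding equations show that the classes of generators contain the identities and are closed
  under both compositions.\<close>

lemma free_fib_cell_fib_chi:
  assumes "A \<in> Cell2 (free_fib C)"
  shows "\<exists>p q. (p, q) \<in> polygon_types C \<and> cls (free_fib C) (fib_relations C) A = fib_chi C p q"
proof -
  let ?c = "cls (free_fib C) (fib_relations C)"
  interpret S: polygraph "Sigma_star C" by (rule Sigma_star_polygraph)
  note K = F.quotient_composable[OF fib_relations_parallel, folded Fib_def]
  show ?thesis
    using assms
  proof (induction A rule: S.free_cell_induct[folded free_fib_def, consumes 1, case_names gen id vcmp hcmp])
    case (gen g)
    then obtain p q where "g = Chi p q" "(p, q) \<in> polygon_types C" by (auto simp: Sigma_star_def)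
    then show ?case unfolding fib_chi_def chi_def by blast
  next
    case (id u)
    then obtain p where p: "p \<in> paths C" "star p = u" using star_surj by blast
    then have "?c (Id2 (free_fib C) u) = fib_chi C p p" "(p, p) \<in> polygon_types C"
      using fib_chi_refl by (simp_all add: Fib_def polygon_types_def)
    then show ?case by blast
  next
    case (vcmp a b)
    then obtain p q p' q' where pq: "(p, q) \<in> polygon_types C" "?c a = fib_chi C p q"
      and pq': "(p', q') \<in> polygon_types C" "?c b = fib_chi C p' q'" by blast
    have "vcomposable (Fib C) (?c b) (?c a)"
      using vcmp(1) K(1)[of a b] by (simp add: vcomposable_def)
    \<comment> \<open>Composability only matches the words \<open>star q\<close> and
      \<open>star p'\<close>; injectivity of \<open>star\<close> turns this into equality of paths,
      as vertical pasting requires.\<close>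
    then have "q = p'"
      using fib_chi_in pq pq' by (simp add: vcomposable_def star_inj)
    then have "?c (VCmp (free_fib C) b a) = fib_chi C p q'" "(p, q') \<in> polygon_types C"
      using F.quotient_VCmp[OF fib_relations_parallel vcmp(1), folded Fib_def] fib_chi_VCmp pq pq'
      by (auto simp: polygon_types_def)
    then show ?case by blast
  next
    case (hcmp a b)
    then obtain p q p' q' where pq: "(p, q) \<in> polygon_types C" "?c a = fib_chi C p q"
      and pq': "(p', q') \<in> polygon_types C" "?c b = fib_chi C p' q'" by blast
    have "hcomposable (Fib C) (?c b) (?c a)"
      using hcmp(1) K(2)[of a b] by (simp add: hcomposable_def)
    \<comment> \<open>In functional order \<open>b\<close> is the left factor, so its paths
      \<open>p'\<close>, \<open>q'\<close> are traversed before \<open>p\<close>,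
      \<open>q\<close>.\<close>
    then have t: "target p' = source p"
      using fib_chi_in pq pq' by (simp add: hcomposable_def Fib_1_cells)
    then have "?c (HCmp (free_fib C) b a) = fib_chi C (concat_path p' p) (concat_path q' q)"
      using F.quotient_HCmp[OF fib_relations_parallel hcmp(1), folded Fib_def] fib_chi_HCmp pq pq'
      by simp
    then show ?case using polygon_types_concat[OF pq'(1) pq(1) t] by blast
  qed
qed

lemma Fib_cell_fib_chi:
  assumes "A \<in> Cell2 (Fib C)"
  shows "\<exists>p q. (p, q) \<in> polygon_types C \<and> A = fib_chi C p q"
  using assms free_fib_cell_fib_chi F.quotient_cell2 unfolding Fib_def by metis

end

theorem theorem1:
  fixes C :: "('o, 'a) category"
  assumes "category C"
  shows "two_thin (Fib C)"
  unfolding two_thin_def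
proof (intro ballI impI)
  interpret category C by (rule assms)
  fix a b
  assume "a \<in> Cell2 (Fib C)" "b \<in> Cell2 (Fib C)"
    and eq: "Src2 (Fib C) a = Src2 (Fib C) b" "Tgt2 (Fib C) a = Tgt2 (Fib C) b"
  then obtain p q p' q' where "(p, q) \<in> polygon_types C" "a = fib_chi C p q"
    "(p', q') \<in> polygon_types C" "b = fib_chi C p' q'"
    using Fib_cell_fib_chi by metis
  \<comment> \<open>Equal boundaries force \<open>p = p'\<close> and \<open>q = q'\<close> by
    injectivity of \<open>star\<close>, so both cells are the same generator.\<close>
  then show "a = b" using eq fib_chi_in by (simp add: star_inj)
qed

end
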